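(* Let $p$ be an odd prime, $k\ge 0$, $r\ge 1$ integers with $s=r-k\ge 1$, and let $0\le l<p^k$. Then the sign balance of the vertex $\lambda=\lambda\big(2r;(x_{(2s,k)},x_{(s,k)}+l)\big)\in V^{2r}_k$ is zero: $$I_\lambda=\sum_{P\in P^{2r}_l}(-1)^{\mathrm{inv}(P)}=0 .$$
   Context: Notation: $x_{(a,k)}=p^k(ap-(a+1))$ for $a\ge1$. $\lambda(c;(n,i))$ denotes the hook partition $(n-i,1^i)$ of $n$, regarded as a vertex on floor $c$ of the $p$-Bratteli diagram. $V^{2r}_k=\{\lambda(2r;(x_{(2s,k)},x_{(s,k)}+l)):0\le l<p^k\}$, where $s=r-k\ge1$; $l$ is the position of the vertex. Paths. $P^{2r}_l$ is the set of all downward paths in the diagram from $\lambda(2r;(x_{(2s,k)},x_{(s,k)}+l))$ to floor $1$. Along a path, blocks $B(i;(m_i,n_i))$ ($m_i$ horizontal nodes and $n_i$ vertical nodes) are removed for $i=2r-1,2r-2,\dots,1$. Explicitly, a path $P$ is determined by arbitrary integers $u_s,u_{s-1},\dots,u_2\in\{0,\dots,p-1\}$ and $u_1\in\{0,\dots,p-2\}$ (distinct choices give distinct paths, and all paths arise). Put $L_s=l$ and, for $j=s,s-1,\dots,2$, $L'_j=L_j+p^ku_j$ and $L_{j-1}=\lfloor L'_j/p\rfloor$. The path visits $\lambda(2(k+j);(x_{(2j,k)},x_{(j,k)}+L_j))$ for $1\le j\le s$, $\lambda(2(k+j)-1;(x_{(2j-1,k)},x_{(j-1,k)}+L'_j))$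 for $2\le j\le s$, and $\lambda(2k+1;(p^k(p-1),L_1+p^ku_1))$; below floor $2k+1$ the path is forced. The blocks are, for $2\le j\le s$, $$m_{2(k+j)-1}=p^ku_j,\quad n_{2(k+j)-1}=p^k(p-1-u_j),\quad n_{2(k+j)-2}=L'_j-\lfloor L'_j/p\rfloor,\quad m_{2(k+j)-2}=p^k(p-1)-n_{2(k+j)-2},$$ and $m_{2k+1}=p^ku_1$, $n_{2k+1}=p^k(p-2-u_1)$. Inversions. For $2k+2\le i<j\le 2r-1$ the pair $(i,j)$ is an inversion of $P$ if $m_i>m_j$ and $n_i<n_j$ (all these blocks have the same size $m_i+n_i=p^k(p-1)$). In addition, by convention, there is one further inversion (at block $2k$) if $u_1<\frac{p-1}{2}$, and none at block $2k$ otherwise; there is no inversion at block $2k+1$, and no inversions are counted from blocks below $2k$. $\mathrm{inv}(P)$ is the total number of inversions of $P$, and $\mathrm{sgn}(P)=(-1)^{\mathrm{inv}(P)}$. *)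

theory Defs
  imports "HOL-Library.FuncSet" "HOL-Computational_Algebra.Primes"
begin

text \<open>
  A partition is a weakly decreasing list of positive parts; \<open>hook n i\<close> is the hook
  \<open>(n - i, 1\<^sup>i)\<close> of \<open>n\<close>, meaningful for \<open>i < n\<close>.
\<close>

definition hook :: "nat \<Rightarrow> nat \<Rightarrow> nat list"
  where "hook n i = (n - i) # replicate i 1"

text \<open>
  \<open>xval p k a = x\<^bsub>(a,k)\<^esub>\<close>. It is used only for \<open>a \<ge> 1\<close> and \<open>p \<ge> 3\<close>, where the
  subtraction does not truncate.
\<close>

definition xval :: "nat \<Rightarrow> nat \<Rightarrow> nat \<Rightarrow> nat"
  where "xval p k a = p ^ k * (a * p - (a + 1))"

definition path_choices :: "nat \<Rightarrow> nat \<Rightarrow> (nat \<Rightarrow> nat) set"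
  where "path_choices p s = (\<Pi>\<^sub>E j\<in>{1..s}. if j = 1 then {0..p - 2} else {0..p - 1})"

text \<open>\<open>pos_steps p k s l u t\<close> is \<open>L\<^bsub>s - t\<^esub>\<close>: the recursion for the positions runs downwards from \<open>s\<close>.\<close>

fun pos_steps :: "nat \<Rightarrow> nat \<Rightarrow> nat \<Rightarrow> nat \<Rightarrow> (nat \<Rightarrow> nat) \<Rightarrow> nat \<Rightarrow> nat"
  where
    "pos_steps p k s l u 0 = l"
  | "pos_steps p k s l u (Suc t) = (pos_steps p k s l u t + p ^ k * u (s - t)) div p"

definition pos :: "nat \<Rightarrow> nat \<Rightarrow> nat \<Rightarrow> nat \<Rightarrow> (nat \<Rightarrow> nat) \<Rightarrow> nat \<Rightarrow> nat"
  where "pos p k s l u j = pos_steps p k s l u (s - j)"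

text \<open>\<open>pos'\<close> at \<open>j\<close> is \<open>L'\<^sub>j\<close>; at \<open>j = 1\<close> it is the leg length on floor \<open>2k + 1\<close>.\<close>

definition pos' :: "nat \<Rightarrow> nat \<Rightarrow> nat \<Rightarrow> nat \<Rightarrow> (nat \<Rightarrow> nat) \<Rightarrow> nat \<Rightarrow> nat"
  where "pos' p k s l u j = pos p k s l u j + p ^ k * u j"

definition path_vertex ::
    "nat \<Rightarrow> nat \<Rightarrow> nat \<Rightarrow> nat \<Rightarrow> (nat \<Rightarrow> nat) \<Rightarrow> nat \<Rightarrow> nat list"
  where "path_vertex p k s l u c =
    (if c = 2 * k + 1 then hook (p ^ k * (p - 1)) (pos' p k s l u 1)
     else if even c then
       (let j = c div 2 - k in hook (xval p k (2 * j)) (xval p k j + pos p k s l u j))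
     else
       (let j = (c + 1) div 2 - k in
         hook (xval p k (2 * j - 1)) (xval p k (j - 1) + pos' p k s l u j)))"

text \<open>
  A downward path is a function sending each floor to the partition visited there. The
  continuation of a path below floor \<open>2k + 1\<close> is forced by its vertex on that floor and
  carries no further data, so a path is recorded on the floors \<open>2k + 1, \<dots>, 2r\<close> only.
\<close>

definition path_of :: "nat \<Rightarrow> nat \<Rightarrow> nat \<Rightarrow> nat \<Rightarrow> (nat \<Rightarrow> nat) \<Rightarrow> nat \<Rightarrow> nat list"
  where "path_of p k r l u = (\<lambda>c\<in>{2 * k + 1..2 * r}. path_vertex p k (r - k) l u c)"

definition paths :: "nat \<Rightarrow> nat \<Rightarrow> nat \<Rightarrow> nat \<Rightarrow> (nat \<Rightarrow> nat list) set"
  where "paths p k r l = path_of p k r l ` path_choices p (r - k)"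

text \<open>
  The block \<open>B(i; (m\<^sub>i, n\<^sub>i))\<close> consists of the nodes removed in passing from floor \<open>i + 1\<close> to
  floor \<open>i\<close>: \<open>m\<^sub>i\<close> of them in the first row and \<open>n\<^sub>i\<close> in the first column.
\<close>

definition block_m :: "(nat \<Rightarrow> nat list) \<Rightarrow> nat \<Rightarrow> nat"
  where "block_m P i = hd (P (i + 1)) - hd (P i)"

definition block_n :: "(nat \<Rightarrow> nat list) \<Rightarrow> nat \<Rightarrow> nat"
  where "block_n P i = length (P (i + 1)) - length (P i)"

definition block_inversions :: "nat \<Rightarrow> nat \<Rightarrow> (nat \<Rightarrow> nat list) \<Rightarrow> (nat \<times> nat) set"
  where "block_inversions k r P =
    {(i, j). 2 * k + 2 \<le> i \<and> i < j \<and> j \<le> 2 * r - 1 \<and>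
             block_m P i > block_m P j \<and> block_n P i < block_n P j}"

text \<open>The parameter \<open>u\<^sub>1\<close> is read off the path from \<open>m\<^bsub>2k+1\<^esub> = p\<^sup>k u\<^sub>1\<close>.\<close>

definition first_choice :: "nat \<Rightarrow> nat \<Rightarrow> (nat \<Rightarrow> nat list) \<Rightarrow> nat"
  where "first_choice p k P = block_m P (2 * k + 1) div p ^ k"

definition path_inv :: "nat \<Rightarrow> nat \<Rightarrow> nat \<Rightarrow> (nat \<Rightarrow> nat list) \<Rightarrow> nat"
  where "path_inv p k r P =
    card (block_inversions k r P) + (if first_choice p k P < (p - 1) div 2 then 1 else 0)"

text \<open>
  All recorded downward paths from the partition \<open>lam\<close> on floor \<open>2r\<close>, for \<open>lam\<close> in the set
  \<open>V\<^sup>2\<^sup>r\<^sub>k\<close> of initial vertices; see \<open>downward_paths_eq\<close> below.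
\<close>

definition downward_paths :: "nat \<Rightarrow> nat \<Rightarrow> nat \<Rightarrow> nat list \<Rightarrow> (nat \<Rightarrow> nat list) set"
  where "downward_paths p k r lam = {P \<in> (\<Union>l\<in>{..<p ^ k}. paths p k r l). P (2 * r) = lam}"

definition sign_balance :: "nat \<Rightarrow> nat \<Rightarrow> nat \<Rightarrow> nat list \<Rightarrow> int"
  where "sign_balance p k r lam = (\<Sum>P\<in>downward_paths p k r lam. (- 1) ^ path_inv p k r P)"


text \<open>
  The blocks read off the vertices are given by the expected closed formulas, and different
  choices give different paths.
\<close>

lemma hd_hook [simp]: "hd (hook n i) = n - i"
  and length_hook [simp]: "length (hook n i) = Suc i"
  by (simp_all add: hook_def)

lemma path_of_start:
  assumes "k < r"
  shows "path_of p k r l u (2 * r) = hook (xval p k (2 * (r - k))) (xval p k (r - k) + l)"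
  using assms by (auto simp: path_of_def path_vertex_def pos_def Let_def)

lemma pos_Suc:
  assumes "1 \<le> j" "j < s"
  shows "pos p k s l u j = pos' p k s l u (Suc j) div p"
proof -
  obtain t where t: "s - j = Suc t" "s - Suc j = t" "s - t = Suc j"
    using assms by (metis Suc_diff_Suc diff_diff_cancel Suc_leI)
  then show ?thesis by (simp add: pos_def pos'_def)
qed

lemma path_choices_le:
  assumes "u \<in> path_choices p s" "1 \<le> j" "j \<le> s"
  shows "u j \<le> p - 1" and "j = 1 \<Longrightarrow> u j \<le> p - 2"
proof -
  have "u j \<in> (if j = 1 then {0..p - 2} else {0..p - 1})"
    using assms unfolding path_choices_def by (intro PiE_mem[of u]) auto
  then show "u j \<le> p - 1" "j = 1 \<Longrightarrow> u j \<le> p - 2" by (auto split: if_splits)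
qed

lemma pos'_less_aux:
  fixes a b v p :: nat
  assumes "a < b" "v \<le> p - 1" "p \<ge> 3"
  shows "a + b * v < b * p"
proof -
  have "a + b * v < b * (v + 1)" using assms by (simp add: algebra_simps)
  also have "\<dots> \<le> b * p" using assms by (intro mult_le_mono) auto
  finally show ?thesis .
qed

lemma pos_less:
  assumes "u \<in> path_choices p s" "l < p ^ k" "p \<ge> 3" "1 \<le> j" "j \<le> s"
  shows "pos p k s l u j < p ^ k"
  using assms(5,4)
proof (induction rule: inc_induct)
  case base
  then show ?case using assms by (simp add: pos_def)
next
  case (step j)
  have "pos' p k s l u (Suc j) < p ^ k * p"
    unfolding pos'_def using step assms path_choices_le(1)[OF assms(1), of "Suc j"]
    by (intro pos'_less_aux) auto
  then show ?case
    using step assms by (simp add: pos_Suc less_mult_imp_div_less)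
qed

lemma pos'_less:
  assumes "u \<in> path_choices p s" "l < p ^ k" "p \<ge> 3" "1 \<le> j" "j \<le> s"
  shows "pos' p k s l u j < p ^ k * p"
  unfolding pos'_def using assms path_choices_le(1)[OF assms(1)] pos_less[OF assms]
  by (intro pos'_less_aux) auto

lemma path_of_even:
  assumes "1 \<le> j" "j \<le> r - k"
  shows "path_of p k r l u (2 * (k + j)) =
    hook (xval p k (2 * j)) (xval p k j + pos p k (r - k) l u j)"
proof -
  have "2 * (k + j) \<in> {2 * k + 1..2 * r}" "2 * (k + j) \<noteq> 2 * k + 1"
    using assms by (auto, presburger?)
  then show ?thesis by (simp add: path_of_def path_vertex_def Let_def)
qed

lemma path_of_odd:
  assumes "2 \<le> j" "j \<le> r - k"
  shows "path_of p k r l u (2 * (k + j) - 1) =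
    hook (xval p k (2 * j - 1)) (xval p k (j - 1) + pos' p k (r - k) l u j)"
proof -
  obtain i where j: "j = Suc i" using assms by (cases j) auto
  have "2 * (k + j) - 1 \<in> {2 * k + 1..2 * r}" "2 * (k + j) - 1 \<noteq> 2 * k + 1"
    "odd (2 * (k + j) - 1)" "(2 * (k + j) - 1 + 1) div 2 - k = j"
    using assms by auto
  then show ?thesis by (simp only: path_of_def path_vertex_def Let_def restrict_apply if_True if_False)
qed

lemma path_of_bottom:
  assumes "k < r"
  shows "path_of p k r l u (2 * k + 1) = hook (p ^ k * (p - 1)) (pos' p k (r - k) l u 1)"
  using assms by (simp add: path_of_def path_vertex_def)

lemma downward_paths_eq:
  assumes "k < r" "l < p ^ k"
  shows "downward_paths p k r (hook (xval p k (2 * (r - k))) (xval p k (r - k) + l)) = paths p k r l"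
proof -
  have "l' = l" if "hook n (i + l') = hook n (i + l)" for n i l'
    using arg_cong[OF that, of length] by simp
  then show ?thesis
    using assms by (force simp: downward_paths_def paths_def path_of_start)
qed

lemma xval_add:
  assumes "1 \<le> a" "p \<ge> 3"
  shows "xval p k (a + b) = xval p k a + p ^ k * (b * (p - 1))"
proof -
  define q where "q = p - 3"
  have q: "p = q + 3" using assms(2) by (simp add: q_def)
  obtain c where c: "a = Suc c" using assms(1) by (cases a) auto
  have "(a + b) * p - (a + b + 1) = (a * p - (a + 1)) + b * (p - 1)"
    by (simp add: q c algebra_simps)
  then show ?thesis by (simp add: xval_def algebra_simps)
qed

lemma xval_double:
  assumes "1 \<le> j" "p \<ge> 3"
  shows "xval p k (2 * j) = xval p k j + p ^ k * (j * (p - 1))"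
  using xval_add[OF assms, of k j] by (simp add: mult_2)

lemma xval_double_minus_one:
  assumes "2 \<le> j" "p \<ge> 3"
  shows "xval p k (2 * j - 1) = xval p k (j - 1) + p ^ k * (j * (p - 1))"
  using xval_add[of "j - 1" p k j] assms by (simp add: mult_2)

lemma path_of_head:
  assumes "p \<ge> 3"
  shows "1 \<le> j \<Longrightarrow> j \<le> r - k \<Longrightarrow> hd (path_of p k r l u (2 * (k + j))) =
           p ^ k * (j * (p - 1)) - pos p k (r - k) l u j"
    and "2 \<le> j \<Longrightarrow> j \<le> r - k \<Longrightarrow> hd (path_of p k r l u (2 * (k + j) - 1)) =
           p ^ k * (j * (p - 1)) - pos' p k (r - k) l u j"
  using assms by (simp_all only: path_of_even path_of_odd xval_double xval_double_minus_one
      hd_hook diff_add_inverse diff_diff_left[symmetric])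

lemma pos'_le_arm:
  assumes "u \<in> path_choices p s" "l < p ^ k" "p \<ge> 3" "2 \<le> j" "j \<le> s"
  shows "pos' p k s l u j < p ^ k * (j * (p - 1))"
proof -
  have "p \<le> 2 * (p - 1)" using assms(3) by simp
  also have "\<dots> \<le> j * (p - 1)" using assms(4) by (intro mult_le_mono) auto
  finally have "p ^ k * p \<le> p ^ k * (j * (p - 1))" by simp
  moreover have "pos' p k s l u j < p ^ k * p"
    using pos'_less[OF assms(1,2,3), of j] assms by simp
  ultimately show ?thesis by linarith
qed

lemma block_odd:
  assumes "u \<in> path_choices p (r - k)" "l < p ^ k" "p \<ge> 3" "2 \<le> j" "j \<le> r - k"
  shows "block_m (path_of p k r l u) (2 * (k + j) - 1) = p ^ k * u j"
    and "block_n (path_of p k r l u) (2 * (k + j) - 1) = p ^ k * (p - 1 - u j)"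
proof -
  let ?P = "path_of p k r l u"
  have i: "2 * (k + j) - 1 + 1 = 2 * (k + j)" using assms by simp
  have L: "pos' p k (r - k) l u j < p ^ k * (j * (p - 1))"
    using pos'_le_arm[OF assms] .
  show "block_m ?P (2 * (k + j) - 1) = p ^ k * u j"
    unfolding block_m_def i using path_of_head[OF assms(3)] assms L by (simp add: pos'_def)
  have x: "xval p k j = xval p k (j - 1) + p ^ k * (p - 1)"
    using xval_add[of "j - 1" p k 1] assms by simp
  show "block_n ?P (2 * (k + j) - 1) = p ^ k * (p - 1 - u j)"
    unfolding block_n_def i using path_of_even[of j r k p l u] path_of_odd[of j r k p l u] assms
    by (simp add: x pos'_def diff_mult_distrib2)
qed

lemma arm_diff_aux:
  fixes a b c d :: nat
  assumes "d \<le> a" "d \<le> c" "c < a + b"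
  shows "(a + b - c) - (a - d) = b - (c - d)"
  using assms by simp

lemma block_even:
  assumes "u \<in> path_choices p (r - k)" "l < p ^ k" "p \<ge> 3" "2 \<le> j" "j \<le> r - k"
  defines "n \<equiv> pos' p k (r - k) l u j - pos' p k (r - k) l u j div p"
  shows "block_m (path_of p k r l u) (2 * (k + j) - 2) = p ^ k * (p - 1) - n"
    and "block_n (path_of p k r l u) (2 * (k + j) - 2) = n"
proof -
  let ?P = "path_of p k r l u" and ?L = "pos' p k (r - k) l u j"
  have i: "2 * (k + j) - 2 + 1 = 2 * (k + j) - 1" "2 * (k + j) - 2 = 2 * (k + (j - 1))"
    using assms(4) by simp_all
  have L: "?L < p ^ k * (j * (p - 1))"
    using pos'_le_arm[OF assms(1-5)] .
  have pos: "pos p k (r - k) l u (j - 1) = ?L div p"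
    using pos_Suc[of "j - 1" "r - k"] assms by simp
  have A: "p ^ k * (j * (p - 1)) = p ^ k * ((j - 1) * (p - 1)) + p ^ k * (p - 1)"
    using assms(4) by (cases j) (simp_all add: distrib_left)
  have "pos p k (r - k) l u (j - 1) < p ^ k"
    using pos_less[OF assms(1-3), of "j - 1"] assms by simp
  moreover have "p ^ k * 1 \<le> p ^ k * ((j - 1) * (p - 1))"
    using assms(3,4) by (intro mult_le_mono) auto
  ultimately have B: "?L div p \<le> p ^ k * ((j - 1) * (p - 1))" unfolding pos by linarith
  have C: "?L div p \<le> ?L" by simp
  have H: "hd (?P (2 * (k + (j - 1)))) = p ^ k * ((j - 1) * (p - 1)) - ?L div p"
    unfolding pos[symmetric] using assms(4,5) by (intro path_of_head(1)[OF assms(3)]) auto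
  have H': "hd (?P (2 * (k + j) - 1)) = p ^ k * (j * (p - 1)) - ?L"
    using path_of_head(2)[OF assms(3,4,5)] .
  show "block_m ?P (2 * (k + j) - 2) = p ^ k * (p - 1) - n"
    unfolding block_m_def i(1) unfolding i(2) H H' n_def A
    by (rule arm_diff_aux[OF B C L[unfolded A]])
  show "block_n ?P (2 * (k + j) - 2) = n"
    unfolding block_n_def i(1) unfolding i(2)
    using path_of_even[of "j - 1" r k p l u] path_of_odd[of j r k p l u] assms
    by (simp add: pos[unfolded One_nat_def])
qed

lemma block_bottom:
  assumes "u \<in> path_choices p (r - k)" "l < p ^ k" "p \<ge> 3" "k < r"
  shows "block_m (path_of p k r l u) (2 * k + 1) = p ^ k * u 1"
    and "block_n (path_of p k r l u) (2 * k + 1) = p ^ k * (p - 2 - u 1)"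
    and "first_choice p k (path_of p k r l u) = u 1"
proof -
  let ?P = "path_of p k r l u" and ?L = "pos p k (r - k) l u 1"
  have i: "2 * k + 1 + 1 = 2 * (k + 1)" by simp
  have L: "?L < p ^ k" using pos_less[OF assms(1-3), of 1] assms(4) by simp
  have u: "u 1 \<le> p - 2" using path_choices_le(2)[OF assms(1), of 1] assms(4) by simp
  have "?L + p ^ k * u 1 < p ^ k * (u 1 + 1)" using L by simp
  also have "\<dots> \<le> p ^ k * (p - 1)" using u assms(3) by (intro mult_le_mono) auto
  finally have A: "?L + p ^ k * u 1 < p ^ k * (p - 1)" .
  show m: "block_m ?P (2 * k + 1) = p ^ k * u 1"
    unfolding block_m_def i using path_of_head(1)[OF assms(3), of 1 r k] path_of_bottom[OF assms(4)] assms A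
    by (simp add: pos'_def)
  show "block_n ?P (2 * k + 1) = p ^ k * (p - 2 - u 1)"
    unfolding block_n_def i using path_of_even[of 1 r k p l u] path_of_bottom[OF assms(4)] assms
    by (simp add: pos'_def xval_def diff_mult_distrib2)
  show "first_choice p k ?P = u 1"
    using assms(3) unfolding first_choice_def m by simp
qed

lemma path_of_inj:
  assumes "l < p ^ k" "p \<ge> 3" "k < r"
  shows "inj_on (path_of p k r l) (path_choices p (r - k))"
proof (rule inj_onI)
  fix u v assume u: "u \<in> path_choices p (r - k)" and v: "v \<in> path_choices p (r - k)"
    and eq: "path_of p k r l u = path_of p k r l v"
  have "u j = v j" if j: "1 \<le> j" "j \<le> r - k" for j
  proof (cases "j = 1")
    case True
    then show ?thesis using block_bottom(3)[OF u assms] block_bottom(3)[OF v assms] eq by simp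
  next
    case False
    then have "p ^ k * u j = p ^ k * v j"
      using block_odd(1)[OF u assms(1,2), of j] block_odd(1)[OF v assms(1,2), of j] eq j by simp
    then show ?thesis using assms(2) by simp
  qed
  then show "u = v"
    using u v unfolding path_choices_def by (intro PiE_ext) auto
qed

end

theory Submission
  imports Defs
begin

text \<open>
  The choice \<open>u\<^sub>1\<close> influences a path only at floor \<open>2k + 1\<close>. Hence the blocks from
  \<open>2k + 2\<close> upwards, and with them the inversions between blocks, do not change under the
  involution \<open>u\<^sub>1 \<mapsto> p - 2 - u\<^sub>1\<close> of \<open>{0, \<dots>, p - 2}\<close>, whereas the conventional inversion at
  block \<open>2k\<close> is switched on or off. The involution therefore reverses the sign.
\<close>

text \<open>The recursion runs downwards from \<open>s\<close>, so the position at \<open>j\<close>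
  is computed from \<open>l\<close> and the choices with index above \<open>j\<close> only. In
  particular the position at 1 does not see \<open>u 1\<close>.\<close>

lemma pos_cong:
  assumes "j \<le> s" "\<And>i. j < i \<Longrightarrow> u i = v i"
  shows "pos p k s l u j = pos p k s l v j"
  using assms
proof (induction rule: inc_induct)
  case base
  then show ?case by (simp add: pos_def)
next
  case (step j)
  then obtain t where "s - j = Suc t" "s - Suc j = t" "s - t = Suc j"
    by (metis Suc_diff_Suc diff_diff_cancel Suc_leI)
  then show ?case using step by (simp add: pos_def)
qed

lemma path_of_cong:
  assumes "\<And>i. 2 \<le> i \<Longrightarrow> u i = v i" "2 * k + 2 \<le> c"
  shows "path_of p k r l u c = path_of p k r l v c"
proof (cases "c \<le> 2 * r")
  case True
  have "pos p k (r - k) l u j = pos p k (r - k) l v j" if "1 \<le> j" "j \<le> r - k" for j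
    using assms that by (intro pos_cong) auto
  moreover have "1 \<le> c div 2 - k" "c div 2 - k \<le> r - k"
    using assms(2) True by auto
  \<comment> \<open>An odd floor in this range is at least \<open>2 * k + 3\<close>, so the choice
    added in \<open>pos'\<close> there has index at least 2.\<close>
  moreover have "2 \<le> (c + 1) div 2 - k" "(c + 1) div 2 - k \<le> r - k" if "odd c"
    using assms(2) True that by (auto elim!: oddE)
  ultimately show ?thesis
    using assms by (auto simp: path_of_def path_vertex_def Let_def pos'_def)
next
  case False
  then show ?thesis by (simp add: path_of_def)
qed

text \<open>Block \<open>i\<close> is read off floors \<open>i\<close> and \<open>i + 1\<close>, and
  only blocks with \<open>2 * k + 2 \<le> i\<close> are compared.\<close>

lemma block_inversions_cong:
  assumes "\<And>c. 2 * k + 2 \<le> c \<Longrightarrow> P c = Q c"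
  shows "block_inversions k r P = block_inversions k r Q"
  using assms by (auto simp: block_inversions_def block_m_def block_n_def)

lemma flip_first_choice:
  assumes "u \<in> path_choices p s" "1 \<le> s"
  shows "u(1 := p - 2 - u 1) \<in> path_choices p s"
  using assms by (auto simp: path_choices_def PiE_iff extensional_def)

lemma path_sign_flip:
  assumes u: "u \<in> path_choices p (r - k)" and "l < p ^ k" "p \<ge> 3" "odd p" "k < r"
  shows "(- 1 :: int) ^ path_inv p k r (path_of p k r l (u(1 := p - 2 - u 1))) =
    - ((- 1) ^ path_inv p k r (path_of p k r l u))"
proof -
  let ?v = "u(1 := p - 2 - u 1)"
  have v: "?v \<in> path_choices p (r - k)"
    using flip_first_choice[OF u] assms by simp
  have "u 1 \<le> p - 2"
    using path_choices_le(2)[OF u, of 1] assms by simp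
  \<comment> \<open>As \<open>p\<close> is odd, the threshold cuts the \<open>p - 1\<close> values
    from 0 to \<open>p - 2\<close> into two equal halves, which the reflection swaps.\<close>
  then have "p - 2 - u 1 < (p - 1) div 2 \<longleftrightarrow> \<not> u 1 < (p - 1) div 2"
    using assms by (auto elim!: oddE)
  moreover have "block_inversions k r (path_of p k r l ?v) = block_inversions k r (path_of p k r l u)"
    by (intro block_inversions_cong path_of_cong) auto
  ultimately show ?thesis
    using block_bottom(3)[OF u] block_bottom(3)[OF v] assms by (auto simp: path_inv_def)
qed

theorem theorem13:
  fixes p k r s l :: nat
  assumes "prime p" and "odd p" and "r \<ge> 1" and "s = r - k" and "s \<ge> 1" and "l < p ^ k"
  shows "sign_balance p k r (hook (xval p k (2 * s)) (xval p k s + l)) = 0"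
proof -
  have p: "p \<ge> 3"
    using prime_ge_2_nat[OF assms(1)] assms(2) by (cases "p = 2") auto
  have k: "k < r" using assms by simp
  define f where "f u = (- 1 :: int) ^ path_inv p k r (path_of p k r l u)" for u
  let ?U = "path_choices p s" and ?flip = "\<lambda>u :: nat \<Rightarrow> nat. u(1 := p - 2 - u 1)"
  have flip: "?flip u \<in> ?U" "?flip (?flip u) = u" "f (?flip u) = - f u" if u: "u \<in> ?U" for u
  proof -
    show "?flip u \<in> ?U"
      using flip_first_choice[OF u assms(5)] .
    \<comment> \<open>The bound on \<open>u 1\<close> keeps the natural subtraction from
      truncating.\<close>
    have "p - 2 - (p - 2 - u 1) = u 1"
      using path_choices_le(2)[OF u, of 1] assms(5) by simp
    then show "?flip (?flip u) = u"
      by (simp only: fun_upd_same fun_upd_upd fun_upd_triv)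
    show "f (?flip u) = - f u"
      unfolding f_def using path_sign_flip[of u p r k l] u p k assms by simp
  qed
  have "sum f ?U = (\<Sum>u\<in>?U. - f u)"
    by (rule sum.reindex_bij_witness[of _ ?flip ?flip]) (use flip in auto)
  then have "sum f ?U = 0" by (simp add: sum_negf)
  \<comment> \<open>Injectivity of \<open>path_of\<close> turns the sum over paths into one over
    choices.\<close>
  moreover have "sign_balance p k r (hook (xval p k (2 * s)) (xval p k s + l)) = sum f ?U"
    using path_of_inj[OF assms(6) p k] assms(4)
    by (simp add: sign_balance_def downward_paths_eq[OF k assms(6)] paths_def f_def sum.reindex)
  ultimately show ?thesis by simp
qed

end
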